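(* Let $\mathcal{P}_1,\ldots,\mathcal{P}_m\subset\mathbb{R}^N$ be $2$-convex-normal lattice polytopes. Then: (1) The Minkowski sum $\mathcal{P}_1+\cdots+\mathcal{P}_m$ has the integer decomposition property; (2) The Cayley sum $\mathcal{P}_1*\cdots*\mathcal{P}_m$ has the integer decomposition property if and only if the tuple $(\mathcal{P}_1,\ldots,\mathcal{P}_m)$ is IDP.
   Context: A lattice polytope is a convex polytope with vertices in $\mathbb{Z}^N$; $n\mathcal{P}=\{n\mathbf{x}:\mathbf{x}\in\mathcal{P}\}$ and sums of sets are Minkowski sums. A lattice polytope $\mathcal{P}\subset\mathbb{R}^N$ is $2$-convex-normal if $2\mathcal{P}=(\mathcal{P}\cap\mathbb{Z}^N)+\mathcal{P}$. A lattice polytope $\mathcal{P}\subset\mathbb{R}^k$ has the integer decomposition property if for every integer $n\ge1$, $n\mathcal{P}\cap\mathbb{Z}^k=((n-1)\mathcal{P}\cap\mathbb{Z}^k)+(\mathcal{P}\cap\mathbb{Z}^k)$. The Cayley sum is $\mathcal{P}_1*\cdots*\mathcal{P}_m=\mathrm{conv}(\{\mathbf{e}_1\}\times\mathcal{P}_1\cup\cdots\cup\{\mathbf{e}_m\}\times\mathcal{P}_m)\subset\mathbb{R}^m\times\mathbb{R}^N$, with $\mathbf{e}_i$ the standard unit vectors of $\mathbb{R}^m$. A tuple $(\mathcal{Q}_1,\ldots,\mathcal{Q}_m)$ of lattice polytopes in $\mathbb{R}^N$ is IDP if for every nonempty $I\subset\{1,\ldots,m\}$, $(\sum_{i\in I}\mathcal{Q}_i)\cap\mathbb{Z}^N=\sum_{i\in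 I}(\mathcal{Q}_i\cap\mathbb{Z}^N)$. *)

theory Defs
  imports "HOL-Analysis.Analysis"
begin

text \<open>
  Minkowski sums are the operations \<open>+\<close> and \<open>\<Sum>\<close> on sets from
  \<open>HOL-Library.Set_Algebras\<close>.
\<close>

text \<open>
  The lattice is defined through \<open>Basis\<close>, so that one definition serves both
  \<open>\<real>\<^sup>N\<close>, as the type \<open>real ^ 'n\<close>, and the space \<open>\<real>\<^sup>m \<times> \<real>\<^sup>N\<close> of Cayley sums, as the type
  \<open>(real ^ 'm) \<times> (real ^ 'n)\<close>; see the two lemmas below.
\<close>

definition integer_lattice :: "'a::euclidean_space set" where
  "integer_lattice = {x. \<forall>b\<in>Basis. x \<bullet> b \<in> \<int>}"

lemma integer_lattice_vec:
  "(integer_lattice :: (real ^ 'n) set) = {x. \<forall>i. x $ i \<in> \<int>}"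
  by (auto simp: integer_lattice_def Basis_vec_def inner_axis)

lemma integer_lattice_prod:
  "(integer_lattice :: ('a::euclidean_space \<times> 'b::euclidean_space) set)
     = integer_lattice \<times> integer_lattice"
  by (auto simp: integer_lattice_def Basis_prod_def ball_Un)

text \<open>As with the library's \<open>polytope\<close>, the empty set is not excluded.\<close>

definition lattice_polytope :: "'a::euclidean_space set \<Rightarrow> bool" where
  "lattice_polytope P \<longleftrightarrow>
     polytope P \<and> (\<forall>v. v extreme_point_of P \<longrightarrow> v \<in> integer_lattice)"

definition dilate :: "nat \<Rightarrow> 'a::real_vector set \<Rightarrow> 'a set" where
  "dilate n P = (\<lambda>x. real n *\<^sub>R x) ` P"

definition two_convex_normal :: "'a::euclidean_space set \<Rightarrow> bool" where
  "two_convex_normal P \<longleftrightarrow>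
     lattice_polytope P \<and> dilate 2 P = (P \<inter> integer_lattice) + P"

definition integer_decomposition_property :: "'a::euclidean_space set \<Rightarrow> bool" where
  "integer_decomposition_property P \<longleftrightarrow>
     lattice_polytope P \<and>
     (\<forall>n\<ge>1. dilate n P \<inter> integer_lattice
        = (dilate (n - 1) P \<inter> integer_lattice) + (P \<inter> integer_lattice))"

text \<open>An \<open>m\<close>-tuple is a function on a finite index type with \<open>m\<close> elements.\<close>

definition cayley_sum :: "('m::finite \<Rightarrow> 'a::euclidean_space set) \<Rightarrow> ((real ^ 'm) \<times> 'a) set" where
  "cayley_sum P = convex hull (\<Union>i. {axis i 1} \<times> P i)"

definition IDP_tuple :: "('m::finite \<Rightarrow> 'a::euclidean_space set) \<Rightarrow> bool" where
  "IDP_tuple Q \<longleftrightarrow>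
     (\<forall>i. lattice_polytope (Q i)) \<and>
     (\<forall>I. I \<noteq> {} \<longrightarrow>
        (\<Sum>i\<in>I. Q i) \<inter> integer_lattice = (\<Sum>i\<in>I. Q i \<inter> integer_lattice))"

end

theory Submission
  imports Defs
begin

text \<open>
  By \<open>2P = (P \<inter> \<int>\<^sup>N) + P\<close> and \<open>t P = 2P + (t - 2) P\<close>, every point of \<open>t P\<close>, for real \<open>t \<ge> 2\<close>, is
  a lattice point of \<open>P\<close> plus a point of \<open>(t - 1) P\<close>. Being \<open>2\<close>-convex-normal is preserved by Minkowski sums, and
  for a lattice point of \<open>n P\<close> the remainder is again a lattice point, which gives (1).
  A point of the \<open>n\<close>-th dilate of the Cayley sum is a pair \<open>(a, \<Sum>i. a\<^sub>i y\<^sub>i)\<close> with \<open>a \<ge> 0\<close>,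
  \<open>\<Sum>i. a\<^sub>i = n\<close> and \<open>y\<^sub>i \<in> P\<^sub>i\<close>. If it is a lattice point and some \<open>a\<^sub>i \<ge> 2\<close>, a lattice point of
  \<open>P\<^sub>i\<close> can be split off as before; otherwise \<open>a\<close> is the indicator vector of a set \<open>I\<close>, and
  decomposing the point amounts to the condition on \<open>I\<close> in the definition of an IDP tuple.
\<close>

section \<open>Minkowski sums and the integer lattice\<close>

lemma mem_set_sum_iff:
  fixes S :: "'i \<Rightarrow> 'a::comm_monoid_add set"
  assumes "finite I"
  shows "x \<in> (\<Sum>i\<in>I. S i) \<longleftrightarrow> (\<exists>s. x = (\<Sum>i\<in>I. s i) \<and> (\<forall>i\<in>I. s i \<in> S i))"
  using set_sum_alt[OF assms, of S] by auto

lemma integer_lattice_0: "0 \<in> integer_lattice"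
  by (simp add: integer_lattice_def)

lemma integer_lattice_add:
  "x \<in> integer_lattice \<Longrightarrow> y \<in> integer_lattice \<Longrightarrow> x + y \<in> integer_lattice"
  by (simp add: integer_lattice_def inner_add_left)

lemma integer_lattice_diff:
  "x \<in> integer_lattice \<Longrightarrow> y \<in> integer_lattice \<Longrightarrow> x - y \<in> integer_lattice"
  by (simp add: integer_lattice_def inner_diff_left)

lemma integer_lattice_sum:
  "(\<And>i. i \<in> I \<Longrightarrow> f i \<in> integer_lattice) \<Longrightarrow> (\<Sum>i\<in>I. f i) \<in> integer_lattice"
  by (induction I rule: infinite_finite_induct) (auto simp: integer_lattice_0 integer_lattice_add)

lemma axis_in_integer_lattice: "axis i 1 \<in> (integer_lattice :: (real ^ 'n) set)"
  by (auto simp: integer_lattice_vec axis_def)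

section \<open>Lattice polytopes as hulls of finite sets of lattice points\<close>

text \<open>One direction takes the extreme points as generators, by Krein-Milman; in the other,
  every extreme point of \<open>convex hull S\<close> lies in \<open>S\<close>. Closure properties
  can then be checked on generators, without determining extreme points.\<close>

lemma lattice_polytope_iff:
  "lattice_polytope P \<longleftrightarrow> (\<exists>S. finite S \<and> S \<subseteq> integer_lattice \<and> P = convex hull S)"
proof
  assume P: "lattice_polytope P"
  then obtain V where V: "finite V" "P = convex hull V"
    unfolding lattice_polytope_def polytope_def by auto
  let ?E = "{x. x extreme_point_of P}"
  have "finite ?E"
    using V extreme_points_of_convex_hull finite_subset by blast
  moreover have "P = convex hull ?E"
    using Krein_Milman_polytope[OF V(1)] V(2) by simp
  moreover have "?E \<subseteq> integer_lattice"
    using P by (auto simp: lattice_polytope_def)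
  ultimately show "\<exists>S. finite S \<and> S \<subseteq> integer_lattice \<and> P = convex hull S"
    by blast
next
  assume "\<exists>S. finite S \<and> S \<subseteq> integer_lattice \<and> P = convex hull S"
  then show "lattice_polytope P"
    unfolding lattice_polytope_def polytope_def using extreme_point_of_convex_hull by blast
qed

lemma lattice_polytope_imp_convex: "lattice_polytope P \<Longrightarrow> convex P"
  by (simp add: lattice_polytope_def polytope_imp_convex)

lemma lattice_polytope_plus:
  assumes "lattice_polytope P" "lattice_polytope Q"
  shows "lattice_polytope (P + Q)"
proof -
  obtain S T where ST: "finite S" "S \<subseteq> integer_lattice" "P = convex hull S"
      "finite T" "T \<subseteq> integer_lattice" "Q = convex hull T"
    using assms unfolding lattice_polytope_iff by blast
  have "S + T \<subseteq> integer_lattice"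
    using ST integer_lattice_add by (auto elim!: set_plus_elim)
  then show ?thesis
    unfolding lattice_polytope_iff
    using ST by (intro exI[of _ "S + T"]) (simp add: finite_set_plus convex_hull_set_plus)
qed

lemma lattice_polytope_singleton: "x \<in> integer_lattice \<Longrightarrow> lattice_polytope {x}"
  unfolding lattice_polytope_iff by (intro exI[of _ "{x}"]) simp

text \<open>Generators of each \<open>P i\<close>, lifted to height \<open>axis i 1\<close>,
  together generate the Cayley sum; the lifted points are again lattice points.\<close>

lemma lattice_polytope_cayley_sum:
  fixes P :: "'m::finite \<Rightarrow> 'a::euclidean_space set"
  assumes "\<And>i. lattice_polytope (P i)"
  shows "lattice_polytope (cayley_sum P)"
proof -
  obtain S where S: "\<And>i. finite (S i) \<and> S i \<subseteq> integer_lattice \<and> P i = convex hull (S i)"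
    using assms unfolding lattice_polytope_iff by metis
  let ?S = "\<Union>i. {axis i 1 :: real ^ 'm} \<times> S i"
  have "{axis i 1} \<times> P i \<subseteq> convex hull ?S" for i
  proof -
    have "{axis i 1} \<times> P i = convex hull ({axis i 1} \<times> S i)"
      using S by (simp add: convex_hull_Times)
    also have "\<dots> \<subseteq> convex hull ?S"
      by (intro hull_mono) blast
    finally show ?thesis .
  qed
  then have "cayley_sum P \<subseteq> convex hull ?S"
    unfolding cayley_sum_def by (intro hull_minimal) auto
  moreover have "convex hull ?S \<subseteq> cayley_sum P"
    unfolding cayley_sum_def using S hull_subset by (intro hull_mono) fastforce
  moreover have "finite ?S"
    using S by auto
  moreover have "?S \<subseteq> integer_lattice"
    using S axis_in_integer_lattice by (auto simp: integer_lattice_prod)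
  ultimately show ?thesis
    unfolding lattice_polytope_iff by (intro exI[of _ ?S]) auto
qed

section \<open>Dilates and 2-convex-normality\<close>

lemma dilate_plus: "dilate n (P + Q) = dilate n P + dilate n Q"
  by (auto simp: dilate_def set_plus_def image_iff scaleR_add_right) (metis scaleR_add_right)+

text \<open>The mean of \<open>u\<close> and \<open>v\<close> with weights \<open>n - 1\<close> and
  \<open>1\<close> lies in \<open>P\<close> by convexity, and \<open>n\<close> times this mean is
  \<open>(n - 1) u + v\<close>.\<close>

lemma dilate_diff_plus_subset:
  assumes "convex P" "n \<ge> 1"
  shows "dilate (n - 1) P + P \<subseteq> dilate n P"
proof
  fix x assume "x \<in> dilate (n - 1) P + P"
  then obtain u v where uv: "u \<in> P" "v \<in> P" "x = real (n - 1) *\<^sub>R u + v"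
    by (auto simp: dilate_def elim!: set_plus_elim)
  let ?w = "(real (n - 1) / real n) *\<^sub>R u + (1 / real n) *\<^sub>R v"
  have "?w \<in> P"
    using assms uv by (intro convexD) (auto simp: field_simps of_nat_diff)
  moreover have "x = real n *\<^sub>R ?w"
    using assms uv by (simp add: scaleR_add_right)
  ultimately show "x \<in> dilate n P"
    by (auto simp: dilate_def)
qed

text \<open>Dilation distributes over Minkowski sums, so the four summands can be regrouped: a
  lattice point of \<open>P\<close> plus one of \<open>Q\<close> is a lattice point of
  \<open>P + Q\<close>. The reverse inclusion is convexity alone.\<close>

lemma two_convex_normal_plus:
  assumes P: "two_convex_normal P" and Q: "two_convex_normal Q"
  shows "two_convex_normal (P + Q)"
proof -
  have conv: "convex (P + Q)"
    using assms by (simp add: two_convex_normal_def convex_set_plus lattice_polytope_imp_convex)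
  have "dilate 2 (P + Q) = (P \<inter> integer_lattice + P) + (Q \<inter> integer_lattice + Q)"
    using assms by (simp add: two_convex_normal_def dilate_plus)
  also have "\<dots> = (P \<inter> integer_lattice + Q \<inter> integer_lattice) + (P + Q)"
    by (simp add: ac_simps)
  also have "\<dots> \<subseteq> (P + Q) \<inter> integer_lattice + (P + Q)"
    using integer_lattice_add by (intro set_plus_mono2) (auto elim!: set_plus_elim)
  finally have "dilate 2 (P + Q) \<subseteq> (P + Q) \<inter> integer_lattice + (P + Q)" .
  moreover have "(P + Q) \<inter> integer_lattice + (P + Q) \<subseteq> dilate (2 - 1) (P + Q) + (P + Q)"
    by (intro set_plus_mono2) (auto simp: dilate_def)
  ultimately show ?thesis
    using assms dilate_diff_plus_subset[OF conv, of 2]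
    by (auto simp: two_convex_normal_def lattice_polytope_plus)
qed

lemma two_convex_normal_sum:
  fixes P :: "'i \<Rightarrow> 'a::euclidean_space set"
  assumes "\<And>i. i \<in> I \<Longrightarrow> two_convex_normal (P i)"
  shows "two_convex_normal (\<Sum>i\<in>I. P i)"
proof -
  \<comment> \<open>As a set, \<open>0\<close> is \<open>{0}\<close>, the value of an empty
    Minkowski sum and hence the base of the induction.\<close>
  have "two_convex_normal (0 :: 'a set)"
    by (simp add: two_convex_normal_def set_zero lattice_polytope_singleton integer_lattice_0
        dilate_def)
  with assms show ?thesis
    by (induction I rule: infinite_finite_induct) (auto simp: two_convex_normal_plus)
qed

text \<open>Normality is applied only to \<open>2 y = z + u\<close>. What remains,
  \<open>u + (t - 2) y\<close>, has nonnegative weights of total \<open>t - 1\<close>, so convexity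
  merges it into \<open>(t - 1) w\<close>.\<close>

lemma two_convex_normal_split:
  assumes P: "two_convex_normal P" and y: "y \<in> P" and t: "t \<ge> 2"
  obtains z w where "z \<in> P" "z \<in> integer_lattice" "w \<in> P" "t *\<^sub>R y = z + (t - 1) *\<^sub>R w"
proof -
  have "2 *\<^sub>R y \<in> P \<inter> integer_lattice + P"
    using P y by (auto simp: two_convex_normal_def dilate_def)
  then obtain z u where zu: "z \<in> P" "z \<in> integer_lattice" "u \<in> P" "2 *\<^sub>R y = z + u"
    by (auto elim!: set_plus_elim)
  define w where "w = (1 / (t - 1)) *\<^sub>R u + ((t - 2) / (t - 1)) *\<^sub>R y"
  have "w \<in> P"
    unfolding w_def using P t zu y
    by (intro convexD lattice_polytope_imp_convex) (auto simp: two_convex_normal_def field_simps)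
  moreover have "(t - 1) *\<^sub>R w = u + (t - 2) *\<^sub>R y"
    using t by (simp add: w_def scaleR_add_right)
  moreover have "t *\<^sub>R y = 2 *\<^sub>R y + (t - 2) *\<^sub>R y"
    by (simp flip: scaleR_add_left)
  ultimately have "w \<in> P" "t *\<^sub>R y = z + (t - 1) *\<^sub>R w"
    using zu(4) by (simp_all add: add.assoc)
  then show ?thesis
    using that zu by blast
qed

section \<open>Establishing the integer decomposition property\<close>

text \<open>It suffices to split off one lattice point: the remainder is a difference of lattice
  points, hence itself a lattice point, and the opposite inclusion follows from convexity.\<close>

lemma integer_decomposition_propertyI:
  assumes P: "lattice_polytope P"
    and step: "\<And>n x. n \<ge> 2 \<Longrightarrow> x \<in> dilate n P \<Longrightarrow> x \<in> integer_lattice \<Longrightarrow>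
      \<exists>z\<in>P \<inter> integer_lattice. x - z \<in> dilate (n - 1) P"
  shows "integer_decomposition_property P"
  unfolding integer_decomposition_property_def
proof (intro conjI allI impI equalityI P)
  fix n :: nat assume n: "n \<ge> 1"
  have "dilate (n - 1) P \<inter> integer_lattice + P \<inter> integer_lattice \<subseteq> dilate (n - 1) P + P"
    by (intro set_plus_mono2) auto
  also have "\<dots> \<subseteq> dilate n P"
    using P n by (intro dilate_diff_plus_subset lattice_polytope_imp_convex)
  finally show "dilate (n - 1) P \<inter> integer_lattice + P \<inter> integer_lattice
      \<subseteq> dilate n P \<inter> integer_lattice"
    using integer_lattice_add by (auto elim!: set_plus_elim)
  show "dilate n P \<inter> integer_lattice
      \<subseteq> dilate (n - 1) P \<inter> integer_lattice + P \<inter> integer_lattice"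
  proof
    fix x assume x: "x \<in> dilate n P \<inter> integer_lattice"
    have "\<exists>z\<in>P \<inter> integer_lattice. x - z \<in> dilate (n - 1) P"
    proof (cases "n = 1")
      case True
      \<comment> \<open>For \<open>n = 1\<close> the point \<open>x\<close> itself is split off; the
        remainder \<open>0\<close> lies in \<open>dilate 0 P\<close> because \<open>P\<close>
        contains \<open>x\<close>.\<close>
      then show ?thesis
        using x by (intro bexI[of _ x]) (auto simp: dilate_def)
    next
      case False
      then show ?thesis
        using n x step[of n x] by auto
    qed
    then obtain z where "z \<in> P \<inter> integer_lattice" "x - z \<in> dilate (n - 1) P"
      by blast
    moreover from this have "x - z \<in> integer_lattice"
      using x by (auto intro: integer_lattice_diff)
    ultimately have "(x - z) + z \<in> dilate (n - 1) P \<inter> integer_lattice + P \<inter> integer_lattice"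
      by (intro set_plus_intro) auto
    then show "x \<in> dilate (n - 1) P \<inter> integer_lattice + P \<inter> integer_lattice"
      by simp
  qed
qed

lemma two_convex_normal_imp_integer_decomposition_property:
  assumes "two_convex_normal P"
  shows "integer_decomposition_property P"
proof (rule integer_decomposition_propertyI)
  show "lattice_polytope P"
    using assms by (simp add: two_convex_normal_def)
next
  fix n x assume n: "(n::nat) \<ge> 2" and "x \<in> dilate n P"
  then obtain y where y: "y \<in> P" "x = real n *\<^sub>R y"
    by (auto simp: dilate_def)
  then obtain z w where "z \<in> P" "z \<in> integer_lattice" "w \<in> P" "x = z + (real n - 1) *\<^sub>R w"
    using two_convex_normal_split[OF assms, of y "real n"] n by auto
  then show "\<exists>z\<in>P \<inter> integer_lattice. x - z \<in> dilate (n - 1) P"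
    using n by (intro bexI[of _ z]) (auto simp: dilate_def of_nat_diff)
qed

section \<open>Points of the Cayley sum and of its dilates\<close>

text \<open>The unit vectors are linearly independent, so the component \<open>a\<close> is itself
  the vector of convex coefficients. Membership of \<open>y i\<close> is tied to
  \<open>0 < a $ i\<close> because some \<open>P i\<close> may be empty.\<close>

lemma mem_cayley_sum_iff:
  fixes P :: "'m::finite \<Rightarrow> 'a::euclidean_space set"
  assumes conv: "\<And>i. convex (P i)"
  shows "(a, x) \<in> cayley_sum P \<longleftrightarrow>
    (\<exists>y. x = (\<Sum>i\<in>UNIV. a $ i *\<^sub>R y i) \<and> (\<Sum>i\<in>UNIV. a $ i) = 1 \<and>
      (\<forall>i. 0 \<le> a $ i \<and> (0 < a $ i \<longrightarrow> y i \<in> P i)))"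
    (is "_ \<longleftrightarrow> (\<exists>y. ?R y)")
proof -
  \<comment> \<open>The formula for the hull of a finite union of convex sets asks for nonempty
    sets, so empty \<open>P i\<close> are dropped first.\<close>
  define I where "I = {i. P i \<noteq> {}}"
  have "cayley_sum P = convex hull (\<Union>i\<in>I. {axis i 1} \<times> P i)"
    unfolding cayley_sum_def I_def by (rule arg_cong[where f = "\<lambda>A. convex hull A"]) auto
  also have "\<dots> = {\<Sum>i\<in>I. c i *\<^sub>R s i |c s. (\<forall>i\<in>I. 0 \<le> c i) \<and> sum c I = 1 \<and>
      (\<forall>i\<in>I. s i \<in> {axis i 1} \<times> P i)}"
    by (rule convex_hull_finite_union) (auto simp: I_def conv convex_Times)
  finally have C: "cayley_sum P = \<dots>" .
  have sum_axis: "(\<Sum>i\<in>I. c i *\<^sub>R axis i 1) = (\<chi> i. if i \<in> I then c i else 0)"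
    for c :: "'m \<Rightarrow> real"
    by (auto simp: vec_eq_iff axis_def if_distrib sum.delta' cong: if_cong)
  show ?thesis
  proof
    assume "(a, x) \<in> cayley_sum P"
    then obtain c s where cs: "(a, x) = (\<Sum>i\<in>I. c i *\<^sub>R s i)" "\<forall>i\<in>I. 0 \<le> c i" "sum c I = 1"
        "\<forall>i\<in>I. s i \<in> {axis i 1} \<times> P i"
      unfolding C by blast
    have "(\<Sum>i\<in>I. c i *\<^sub>R s i) = (\<Sum>i\<in>I. (c i *\<^sub>R axis i 1, c i *\<^sub>R snd (s i)))"
      using cs(4) by (intro sum.cong) (auto simp: prod_eq_iff)
    then have a: "a = (\<chi> i. if i \<in> I then c i else 0)" and x: "x = (\<Sum>i\<in>I. c i *\<^sub>R snd (s i))"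
      using cs(1) by (simp_all add: sum_prod sum_axis)
    have "x = (\<Sum>i\<in>UNIV. a $ i *\<^sub>R snd (s i))"
      unfolding x by (intro sum.mono_neutral_cong_left) (auto simp: a)
    moreover have "(\<Sum>i\<in>UNIV. a $ i) = sum c I"
      by (intro sum.mono_neutral_cong_right) (auto simp: a)
    ultimately show "\<exists>y. ?R y"
      using cs by (intro exI[of _ "\<lambda>i. snd (s i)"]) (auto simp: a)
  next
    assume "\<exists>y. ?R y"
    then obtain y where y: "?R y" ..
    then have pos: "i \<in> I" if "0 < a $ i" for i
      using that by (auto simp: I_def)
    have a0: "a $ i = 0" if "\<not> 0 < a $ i" for i
      using y that by (meson order.antisym not_le)
    have out: "a $ i = 0" if "i \<notin> I" for i
      using that a0 pos by blast
    \<comment> \<open>Where \<open>a $ i = 0\<close>, the point \<open>y i\<close> may lie outside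
      \<open>P i\<close>; an arbitrary point of \<open>P i\<close> replaces it, and its zero
      coefficient removes it from the sum.\<close>
    define s where "s i = (axis i (1::real), if 0 < a $ i then y i else (SOME p. p \<in> P i))" for i
    have s: "\<forall>i\<in>I. s i \<in> {axis i 1} \<times> P i"
      using y by (auto simp: s_def I_def some_in_eq)
    have "(\<Sum>i\<in>I. a $ i *\<^sub>R s i) = (\<Sum>i\<in>I. (a $ i *\<^sub>R axis i 1, a $ i *\<^sub>R y i))"
      using a0 by (intro sum.cong) (auto simp: s_def)
    also have "\<dots> = (\<Sum>i\<in>I. a $ i *\<^sub>R axis i 1, \<Sum>i\<in>I. a $ i *\<^sub>R y i)"
      by (simp add: sum_prod)
    also have "(\<Sum>i\<in>I. a $ i *\<^sub>R axis i 1) = a"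
      unfolding sum_axis using out by (auto simp: vec_eq_iff)
    also have "(\<Sum>i\<in>I. a $ i *\<^sub>R y i) = x"
      using y out by (auto intro!: sum.mono_neutral_left)
    finally have "(a, x) = (\<Sum>i\<in>I. a $ i *\<^sub>R s i)" by simp
    moreover have "(\<Sum>i\<in>I. a $ i) = (\<Sum>i\<in>UNIV. a $ i)"
      using out by (intro sum.mono_neutral_left) auto
    then have "(\<Sum>i\<in>I. a $ i) = 1"
      using y by simp
    ultimately show "(a, x) \<in> cayley_sum P"
      unfolding C using y s by blast
  qed
qed

text \<open>The Cayley sum must be nonempty because \<open>dilate 0 {} = {}\<close>, not \<open>{0}\<close>.\<close>

lemma mem_dilate_cayley_sum_iff:
  fixes P :: "'m::finite \<Rightarrow> 'a::euclidean_space set"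
  assumes conv: "\<And>i. convex (P i)" and ne: "cayley_sum P \<noteq> {}"
  shows "(a, x) \<in> dilate n (cayley_sum P) \<longleftrightarrow>
    (\<exists>y. x = (\<Sum>i\<in>UNIV. a $ i *\<^sub>R y i) \<and> (\<Sum>i\<in>UNIV. a $ i) = real n \<and>
      (\<forall>i. 0 \<le> a $ i \<and> (0 < a $ i \<longrightarrow> y i \<in> P i)))"
    (is "_ \<longleftrightarrow> (\<exists>y. ?R y)")
proof (cases "n = 0")
  case True
  have "(\<exists>y. ?R y) \<longleftrightarrow> (a, x) = (0, 0)"
  proof
    assume "\<exists>y. ?R y"
    then have "\<forall>i. a $ i = 0" "\<exists>y. x = (\<Sum>i\<in>UNIV. a $ i *\<^sub>R y i)"
      using True by (auto simp: sum_nonneg_eq_0_iff)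
    then show "(a, x) = (0, 0)"
      by (auto simp: vec_eq_iff)
  qed (auto simp: True)
  moreover have "dilate n (cayley_sum P) = {0}"
    using ne True by (auto simp: dilate_def)
  ultimately show ?thesis
    by (simp add: zero_prod_def)
next
  case False
  \<comment> \<open>Division by \<open>n > 0\<close> reduces to the undilated case; the same points
    \<open>y i\<close> serve before and after scaling.\<close>
  have "(a, x) \<in> dilate n (cayley_sum P) \<longleftrightarrow>
      ((1 / real n) *\<^sub>R a, (1 / real n) *\<^sub>R x) \<in> cayley_sum P"
    using False by (force simp: dilate_def image_iff)
  also have "\<dots> \<longleftrightarrow> (\<exists>y. ?R y)"
  proof -
    have "(1 / real n) *\<^sub>R x = (\<Sum>i\<in>UNIV. ((1 / real n) *\<^sub>R a) $ i *\<^sub>R y i) \<longleftrightarrow>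
        x = (\<Sum>i\<in>UNIV. a $ i *\<^sub>R y i)" for y
    proof -
      have "(\<Sum>i\<in>UNIV. ((1 / real n) *\<^sub>R a) $ i *\<^sub>R y i) = (1 / real n) *\<^sub>R (\<Sum>i\<in>UNIV. a $ i *\<^sub>R y i)"
        by (simp add: scaleR_sum_right)
      then show ?thesis
        using False by (simp only: scaleR_left_imp_eq scaleR_cancel_left) simp
    qed
    moreover have "(\<Sum>i\<in>UNIV. ((1 / real n) *\<^sub>R a) $ i) = 1 \<longleftrightarrow> (\<Sum>i\<in>UNIV. a $ i) = real n"
      using False by (auto simp flip: sum_divide_distrib)
    moreover have "0 \<le> ((1 / real n) *\<^sub>R a) $ i \<longleftrightarrow> 0 \<le> a $ i"
        "0 < ((1 / real n) *\<^sub>R a) $ i \<longleftrightarrow> 0 < a $ i" for i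
      using False by (simp_all add: zero_le_divide_iff zero_less_divide_iff)
    ultimately show ?thesis
      unfolding mem_cayley_sum_iff[OF conv] by simp
  qed
  finally show ?thesis .
qed

text \<open>A vector of nonnegative integers with sum 1 is a unit vector, so the convex combination
  has the single term \<open>y i\<close>.\<close>

lemma lattice_point_cayley_sum:
  fixes P :: "'m::finite \<Rightarrow> 'a::euclidean_space set"
  assumes conv: "\<And>i. convex (P i)"
    and C: "(a, x) \<in> cayley_sum P" and lat: "(a, x) \<in> integer_lattice"
  obtains i where "a = axis i 1" "x \<in> P i" "x \<in> integer_lattice"
proof -
  obtain y where y: "x = (\<Sum>i\<in>UNIV. a $ i *\<^sub>R y i)" "(\<Sum>i\<in>UNIV. a $ i) = 1"
      "\<And>i. 0 \<le> a $ i" "\<And>i. 0 < a $ i \<Longrightarrow> y i \<in> P i"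
    using C unfolding mem_cayley_sum_iff[OF conv] by blast
  have int: "a $ i \<in> \<int>" and x: "x \<in> integer_lattice" for i
    using lat by (auto simp: integer_lattice_prod integer_lattice_vec)
  obtain i where i: "a $ i \<noteq> 0"
    using y(2) by (metis sum.neutral zero_neq_one)
  then have "1 \<le> a $ i"
    using int[of i] y(3)[of i] Ints_nonzero_abs_ge1[of "a $ i"] by simp
  moreover have split: "(\<Sum>j\<in>UNIV. a $ j) = a $ i + (\<Sum>j\<in>UNIV - {i}. a $ j)"
    by (rule sum.remove) auto
  moreover have "0 \<le> (\<Sum>j\<in>UNIV - {i}. a $ j)"
    using y(3) by (intro sum_nonneg)
  ultimately have ai: "a $ i = 1" and "(\<Sum>j\<in>UNIV - {i}. a $ j) = 0"
    using y(2) by linarith+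
  then have "a $ j = 0" if "j \<noteq> i" for j
    using that y(3) by (simp add: sum_nonneg_eq_0_iff)
  then have a: "a = axis i 1"
    using ai by (auto simp: vec_eq_iff axis_def)
  have "x = (\<Sum>j\<in>UNIV. if j = i then y j else 0)"
    unfolding y(1) by (intro sum.cong) (auto simp: a axis_def)
  then have "x = y i" by simp
  then show ?thesis
    using that a x y(4)[of i] ai by auto
qed

section \<open>From the Cayley sum to the tuple\<close>

text \<open>The Cayley trick: with weight 1 on \<open>I\<close> and 0 elsewhere, the summands of
  \<open>x\<close> are the points required in the dilate. Minkowski sums thus appear as fibres over
  indicator vectors.\<close>

lemma indicator_mem_dilate_cayley_sum:
  fixes P :: "'m::finite \<Rightarrow> 'a::euclidean_space set"
  assumes "\<And>i. convex (P i)" "cayley_sum P \<noteq> {}" "x \<in> (\<Sum>i\<in>I. P i)"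
  shows "(\<chi> i. indicator I i, x) \<in> dilate (card I) (cayley_sum P)"
proof -
  obtain s where "x = (\<Sum>i\<in>I. s i)" "\<forall>i\<in>I. s i \<in> P i"
    using assms(3) by (auto simp: mem_set_sum_iff)
  moreover from this have "x = (\<Sum>i\<in>UNIV. indicator I i *\<^sub>R s i)"
    by (auto intro!: sum.mono_neutral_cong_left)
  ultimately show ?thesis
    unfolding mem_dilate_cayley_sum_iff[OF assms(1,2)]
    by (intro exI[of _ s]) (auto simp: indicator_def sum.If_cases)
qed

text \<open>Induction on \<open>card I\<close>: the lattice point split off from the Cayley sum has
  the form \<open>(axis i 1, z)\<close> with \<open>z\<close> in \<open>P i\<close>, and the
  remainder lies over the indicator vector of \<open>I - {i}\<close>.\<close>

lemma indicator_dilate_cayley_sum_decompose: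
  fixes P :: "'m::finite \<Rightarrow> 'a::euclidean_space set"
  assumes C: "integer_decomposition_property (cayley_sum P)" and conv: "\<And>i. convex (P i)"
  shows "(\<chi> i. indicator I i, x) \<in> dilate (card I) (cayley_sum P) \<Longrightarrow> x \<in> integer_lattice \<Longrightarrow>
    x \<in> (\<Sum>i\<in>I. P i \<inter> integer_lattice)"
proof (induction "card I" arbitrary: I x)
  case 0
  then have "I = {}" by simp
  with 0 show ?case
    by (auto simp: dilate_def zero_prod_def)
next
  case (Suc k)
  let ?e = "\<lambda>I. (\<chi> i. indicator I i) :: real ^ 'm"
  have ne: "cayley_sum P \<noteq> {}"
    using Suc.prems by (auto simp: dilate_def)
  have "(?e I, x) \<in> integer_lattice"
    using Suc.prems by (auto simp: integer_lattice_prod integer_lattice_vec indicator_def)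
  then have "(?e I, x) \<in> dilate (Suc k) (cayley_sum P) \<inter> integer_lattice"
    using Suc.prems Suc.hyps(2) by simp
  also have "dilate (Suc k) (cayley_sum P) \<inter> integer_lattice
      = dilate (Suc k - 1) (cayley_sum P) \<inter> integer_lattice + cayley_sum P \<inter> integer_lattice"
    using C by (simp add: integer_decomposition_property_def)
  finally have "(?e I, x) \<in> dilate k (cayley_sum P) \<inter> integer_lattice
      + cayley_sum P \<inter> integer_lattice" by simp
  then obtain a y b z where *: "(?e I, x) = (a, y) + (b, z)"
      "(a, y) \<in> dilate k (cayley_sum P)" "(a, y) \<in> integer_lattice"
      "(b, z) \<in> cayley_sum P" "(b, z) \<in> integer_lattice"
    by (elim set_plus_elim) (metis IntD1 IntD2 surj_pair)
  obtain i where i: "b = axis i 1" "z \<in> P i" "z \<in> integer_lattice"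
    using lattice_point_cayley_sum[OF conv *(4,5)] by blast
  have a: "a = ?e I - axis i 1" and x: "x = y + z"
    using *(1) i by auto
  \<comment> \<open>If \<open>i\<close> were outside \<open>I\<close>, this coordinate of the
    remainder would be -1.\<close>
  have "0 \<le> a $ i"
    using *(2) unfolding mem_dilate_cayley_sum_iff[OF conv ne] by blast
  then have "i \<in> I"
    by (cases "i \<in> I") (auto simp: a axis_def)
  then have "a = ?e (I - {i})"
    by (auto simp: a vec_eq_iff axis_def indicator_def)
  moreover have "k = card (I - {i})"
    using Suc.hyps(2) \<open>i \<in> I\<close> by simp
  moreover have "y \<in> integer_lattice"
    using *(3) by (simp add: integer_lattice_prod)
  ultimately have "y \<in> (\<Sum>j\<in>I - {i}. P j \<inter> integer_lattice)"
    using Suc.hyps(1) *(2) by blast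
  then have "z + y \<in> P i \<inter> integer_lattice + (\<Sum>j\<in>I - {i}. P j \<inter> integer_lattice)"
    using i by (intro set_plus_intro) auto
  also have "\<dots> = (\<Sum>j\<in>I. P j \<inter> integer_lattice)"
    using \<open>i \<in> I\<close> by (intro sum.remove[symmetric]) auto
  finally show ?case
    by (simp only: x add.commute)
qed

lemma cayley_sum_IDP_imp_IDP_tuple:
  fixes P :: "'m::finite \<Rightarrow> 'a::euclidean_space set"
  assumes C: "integer_decomposition_property (cayley_sum P)" and P: "\<And>i. lattice_polytope (P i)"
  shows "IDP_tuple P"
  unfolding IDP_tuple_def
proof (intro conjI allI impI equalityI subsetI P)
  fix I :: "'m set" and x
  assume I: "I \<noteq> {}" and x: "x \<in> (\<Sum>i\<in>I. P i) \<inter> integer_lattice"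
  have conv: "\<And>i. convex (P i)"
    using P by (rule lattice_polytope_imp_convex)
  \<comment> \<open>A point of the Minkowski sum over the nonempty \<open>I\<close> makes the Cayley
    sum nonempty, as the description of its dilates requires.\<close>
  have "P i \<noteq> {}" if "i \<in> I" for i
    using x that by (auto simp: mem_set_sum_iff)
  then have "cayley_sum P \<noteq> {}"
    using I by (auto simp: cayley_sum_def)
  then show "x \<in> (\<Sum>i\<in>I. P i \<inter> integer_lattice)"
    using indicator_dilate_cayley_sum_decompose[OF C conv] indicator_mem_dilate_cayley_sum conv x
    by blast
next
  fix I :: "'m set" and x
  assume "x \<in> (\<Sum>i\<in>I. P i \<inter> integer_lattice)"
  then show "x \<in> (\<Sum>i\<in>I. P i) \<inter> integer_lattice"
    by (auto simp: mem_set_sum_iff intro: integer_lattice_sum)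
qed

section \<open>From the tuple to the Cayley sum\<close>

lemma IDP_tuple_imp_cayley_sum_IDP:
  fixes P :: "'m::finite \<Rightarrow> 'a::euclidean_space set"
  assumes P: "\<And>i. two_convex_normal (P i)" and T: "IDP_tuple P"
  shows "integer_decomposition_property (cayley_sum P)"
proof (rule integer_decomposition_propertyI)
  have lat: "\<And>i. lattice_polytope (P i)" and conv: "\<And>i. convex (P i)"
    using P by (auto simp: two_convex_normal_def lattice_polytope_imp_convex)
  then show "lattice_polytope (cayley_sum P)"
    by (intro lattice_polytope_cayley_sum)
  fix n and ax :: "(real ^ 'm) \<times> 'a"
  assume n: "(n::nat) \<ge> 2" and ax: "ax \<in> dilate n (cayley_sum P)" "ax \<in> integer_lattice"
  obtain a x where [simp]: "ax = (a, x)" by fastforce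
  have ne: "cayley_sum P \<noteq> {}"
    using ax by (auto simp: dilate_def)
  note mem_dilate = mem_dilate_cayley_sum_iff[OF conv ne]
  obtain y where y: "x = (\<Sum>i\<in>UNIV. a $ i *\<^sub>R y i)" "(\<Sum>i\<in>UNIV. a $ i) = real n"
      "\<And>i. 0 \<le> a $ i" "\<And>i. 0 < a $ i \<Longrightarrow> y i \<in> P i"
    using ax unfolding \<open>ax = (a, x)\<close> mem_dilate by blast
  have int: "a $ i \<in> \<int>" and x: "x \<in> integer_lattice" for i
    using ax by (auto simp: integer_lattice_prod integer_lattice_vec)
  \<comment> \<open>Common outcome of both cases: \<open>(axis i 1, z)\<close> is the point to split
    off, and the \<open>w j\<close> with weights \<open>a - axis i 1\<close> represent the
    remainder. The bound \<open>1 \<le> a $ i\<close> keeps these weights nonnegative.\<close>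
  have "\<exists>i z w. 1 \<le> a $ i \<and> z \<in> P i \<and> z \<in> integer_lattice \<and>
      x = z + (\<Sum>j\<in>UNIV. (a - axis i 1) $ j *\<^sub>R w j) \<and>
      (\<forall>j. 0 < (a - axis i 1) $ j \<longrightarrow> w j \<in> P j)"
  proof (cases "\<exists>i. 2 \<le> a $ i")
    case True
    then obtain i where i: "2 \<le> a $ i" ..
    then have "y i \<in> P i"
      using y(4) by simp
    then obtain z w where zw: "z \<in> P i" "z \<in> integer_lattice" "w \<in> P i"
        "a $ i *\<^sub>R y i = z + (a $ i - 1) *\<^sub>R w"
      using two_convex_normal_split[OF P _ i] by blast
    have "x = a $ i *\<^sub>R y i + (\<Sum>j\<in>UNIV - {i}. a $ j *\<^sub>R y j)"
      unfolding y(1) by (rule sum.remove) auto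
    \<comment> \<open>Only the \<open>i\<close>-th term changes: its weight drops by one and its
      point becomes \<open>w\<close>, whence \<open>y(i := w)\<close>.\<close>
    also have "(\<Sum>j\<in>UNIV - {i}. a $ j *\<^sub>R y j)
        = (\<Sum>j\<in>UNIV - {i}. (a - axis i 1) $ j *\<^sub>R (y(i := w)) j)"
      by (intro sum.cong) (auto simp: axis_def)
    also have "a $ i *\<^sub>R y i = z + (a - axis i 1) $ i *\<^sub>R (y(i := w)) i"
      by (simp add: zw(4))
    finally have "x = z + ((a - axis i 1) $ i *\<^sub>R (y(i := w)) i
        + (\<Sum>j\<in>UNIV - {i}. (a - axis i 1) $ j *\<^sub>R (y(i := w)) j))"
      by (simp only: add.assoc)
    also have "(a - axis i 1) $ i *\<^sub>R (y(i := w)) i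
        + (\<Sum>j\<in>UNIV - {i}. (a - axis i 1) $ j *\<^sub>R (y(i := w)) j)
        = (\<Sum>j\<in>UNIV. (a - axis i 1) $ j *\<^sub>R (y(i := w)) j)"
      by (rule sum.remove[symmetric]) auto
    finally show ?thesis
      using i zw y(4)
      by (intro exI[of _ i] exI[of _ z] exI[of _ "y(i := w)"]) (auto simp: axis_def)
  next
    case False
    define I where "I = {i. a $ i \<noteq> 0}"
    \<comment> \<open>With no entry at least 2, the nonnegative integer entries are 0 or 1, and
      \<open>a\<close> is the indicator vector of \<open>I\<close>.\<close>
    have one: "a $ i = 1" if "a $ i \<noteq> 0" for i
    proof -
      obtain k where "a $ i = of_int k"
        using int[of i] by (auto elim: Ints_cases)
      then show ?thesis
        using False[simplified, rule_format, of i] y(3)[of i] that by simp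
    qed
    then have a: "a $ i = (if i \<in> I then 1 else 0)" for i
      by (auto simp: I_def)
    have "I \<noteq> {}"
      using y(2) n by (auto simp: a)
    then obtain i where i: "i \<in> I" by blast
    have "x = (\<Sum>i\<in>I. y i)"
      unfolding y(1) by (simp add: a if_distrib[of "\<lambda>c. c *\<^sub>R _"] sum.If_cases)
    then have "x \<in> (\<Sum>i\<in>I. P i) \<inter> integer_lattice"
      using x y(4) by (auto simp: mem_set_sum_iff a)
    then have "x \<in> (\<Sum>i\<in>I. P i \<inter> integer_lattice)"
      using T \<open>I \<noteq> {}\<close> by (auto simp: IDP_tuple_def)
    then obtain w where w: "x = (\<Sum>i\<in>I. w i)" "\<forall>i\<in>I. w i \<in> P i \<inter> integer_lattice"
      by (auto simp: mem_set_sum_iff)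
    \<comment> \<open>Any \<open>i\<close> in \<open>I\<close> will do: \<open>w i\<close> is split
      off, and the other \<open>w j\<close> carry weight 1 in the remainder.\<close>
    have diff: "(a - axis i 1) $ j = (if j \<in> I - {i} then 1 else 0)" for j
      using i by (simp add: a axis_def)
    have "x = w i + (\<Sum>j\<in>I - {i}. w j)"
      unfolding w(1) using i by (intro sum.remove) auto
    also have "(\<Sum>j\<in>I - {i}. w j) = (\<Sum>j\<in>UNIV. (a - axis i 1) $ j *\<^sub>R w j)"
      unfolding diff by (intro sum.mono_neutral_cong_left) auto
    finally have "x = w i + (\<Sum>j\<in>UNIV. (a - axis i 1) $ j *\<^sub>R w j)" .
    moreover have "w j \<in> P j" if "0 < (a - axis i 1) $ j" for j
      using that w(2) unfolding diff by (simp split: if_splits)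
    ultimately show ?thesis
      using i w(2) a by (intro exI[of _ i] exI[of _ "w i"] exI[of _ w]) simp
  qed
  then obtain i z w where i: "1 \<le> a $ i" and z: "z \<in> P i" "z \<in> integer_lattice"
      and w: "x = z + (\<Sum>j\<in>UNIV. (a - axis i 1) $ j *\<^sub>R w j)"
        "\<And>j. 0 < (a - axis i 1) $ j \<Longrightarrow> w j \<in> P j"
    by blast
  have "(axis i 1, z) \<in> cayley_sum P"
    unfolding cayley_sum_def using z by (intro hull_inc) auto
  moreover have "(axis i (1::real), z) \<in> integer_lattice"
    using z by (simp add: integer_lattice_prod axis_in_integer_lattice)
  moreover have "(a - axis i 1, x - z) \<in> dilate (n - 1) (cayley_sum P)"
    unfolding mem_dilate
  proof (intro exI[of _ w] conjI allI impI)
    show "x - z = (\<Sum>j\<in>UNIV. (a - axis i 1) $ j *\<^sub>R w j)"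
      using w(1) by simp
    show "(\<Sum>j\<in>UNIV. (a - axis i 1) $ j) = real (n - 1)"
      using n y(2) by (simp add: sum_subtractf axis_def of_nat_diff)
    show "0 \<le> (a - axis i 1) $ j" for j
      using i y(3)[of j] by (auto simp: axis_def)
  qed (use w(2) in blast)
  ultimately show "\<exists>z\<in>cayley_sum P \<inter> integer_lattice. ax - z \<in> dilate (n - 1) (cayley_sum P)"
    by (intro bexI[of _ "(axis i 1, z)"]) auto
qed

theorem theorem2p1:
  fixes P :: "'m::finite \<Rightarrow> (real ^ 'n::finite) set"
  assumes "\<And>i. two_convex_normal (P i)"
  shows "integer_decomposition_property (\<Sum>i\<in>UNIV. P i) \<and>
         (integer_decomposition_property (cayley_sum P) \<longleftrightarrow> IDP_tuple P)"
proof (intro conjI iffI)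
  show "integer_decomposition_property (\<Sum>i\<in>UNIV. P i)"
    using assms
    by (intro two_convex_normal_imp_integer_decomposition_property two_convex_normal_sum)
  show "IDP_tuple P" if "integer_decomposition_property (cayley_sum P)"
    using cayley_sum_IDP_imp_IDP_tuple[OF that] assms by (auto simp: two_convex_normal_def)
  show "integer_decomposition_property (cayley_sum P)" if "IDP_tuple P"
    using IDP_tuple_imp_cayley_sum_IDP[OF assms that] .
qed

end
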